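(* Let $\hbar,m>0$ be constants and put $\alpha=-\dfrac{\hbar}{2m}$, $\beta=\dfrac1\hbar$. Let $n\in\{0,1,2,\dots\}$, let $T\subseteq\mathbb{R}$ be an open time interval, let $\sigma:T\to(0,\infty)$ be sufficiently smooth (at least $C^1$), let $E_n:T\to\mathbb{R}$ be a function with $\dot E_n(t)=-\frac{\alpha}{\beta\sigma^2(t)}\left(n+\frac12\right)$, and let $$\Psi_n^1(x,t)=\frac{1}{\sqrt{2^n n!}}\,\frac{1}{\sqrt{\sqrt{2\pi}\,\sigma(t)}}\exp\left(-\frac{x^2}{4\sigma^2(t)}-i\frac{\dot\sigma(t)}{4\alpha\,\sigma(t)}x^2-i\beta E_n(t)\right)H_n\left(\frac{x}{\sqrt2\,\sigma(t)}\right).$$ Then the Wigner function $$W_n(x,p,t)=\frac{1}{2\pi\hbar}\int_{-\infty}^{+\infty}\overline{\Psi_n^1}\left(x-\frac s2,t\right)\Psi_n^1\left(x+\frac s2,t\right)e^{-i\frac{ps}{\hbar}}\,ds$$ has, for all $x,p\in\mathbb{R}$ and $t\in T$, the form $$W_n(x,p,t)=\frac{(-1)^n}{\pi\hbar}\,e^{-\varepsilon(x,p,t)}\,L_n\big(2\varepsilon(x,p,t)\big),$$ where $$\varepsilon(x,p,t)=\kappa^2(t)x^2+\left[\sigma(t)\dot\sigma(t)\frac{x}{\alpha}\kappa(t)+\frac{p}{\kappa(t)\hbar}\right]^2,\qquad \kappa(t)=\frac{1}{\sigma(t)\sqrt2}.$$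
   Context: $H_n$ denotes the physicists' Hermite polynomial of degree $n$ (so $H_0=1$, $H_1(y)=2y$, $H_n'=2nH_{n-1}$), and $L_n$ the Laguerre polynomial $L_n(y)=\sum_{k=0}^n\binom nk\frac{(-y)^k}{k!}$. A dot denotes the derivative with respect to time $t$; the overline denotes complex conjugation. *)

theory Defs
  imports "HOL-Probability.Probability" "HOL-Computational_Algebra.Polynomial"
begin

text \<open>
  Physicists' normalisation of the Hermite polynomials, given by the three-term recurrence.
  The lemmas below establish the degree, the rule \<open>H\<^sub>n' = 2 n H\<^sub>n\<^sub>-\<^sub>1\<close> and
  Rodrigues' formula.
\<close>

fun hermite :: "nat \<Rightarrow> real poly" where
  "hermite 0 = 1"
| "hermite (Suc 0) = [:0, 2:]"
| "hermite (Suc (Suc n)) = [:0, 2:] * hermite (Suc n) - smult (2 * real (Suc n)) (hermite n)"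

definition laguerre :: "nat \<Rightarrow> real \<Rightarrow> real" where
  "laguerre n y = (\<Sum>k\<le>n. real (n choose k) * ((- y) ^ k / fact k))"

definition Psi ::
  "real \<Rightarrow> real \<Rightarrow> (real \<Rightarrow> real) \<Rightarrow> (real \<Rightarrow> real) \<Rightarrow> nat \<Rightarrow> real \<Rightarrow> real \<Rightarrow> complex" where
  "Psi \<alpha> \<beta> \<sigma> E n x t =
     complex_of_real (1 / sqrt (2 ^ n * fact n)) *
     complex_of_real (1 / sqrt (sqrt (2 * pi) * \<sigma> t)) *
     exp (- complex_of_real (x\<^sup>2 / (4 * (\<sigma> t)\<^sup>2))
          - \<i> * complex_of_real (deriv \<sigma> t / (4 * \<alpha> * \<sigma> t) * x\<^sup>2)
          - \<i> * complex_of_real (\<beta> * E t)) *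
     complex_of_real (poly (hermite n) (x / (sqrt 2 * \<sigma> t)))"

definition wigner_integrand ::
  "real \<Rightarrow> (real \<Rightarrow> real \<Rightarrow> complex) \<Rightarrow> real \<Rightarrow> real \<Rightarrow> real \<Rightarrow> real \<Rightarrow> complex" where
  "wigner_integrand hbar \<psi> x p t s =
     cnj (\<psi> (x - s / 2) t) * \<psi> (x + s / 2) t * exp (- \<i> * complex_of_real (p * s / hbar))"

definition wigner ::
  "real \<Rightarrow> (real \<Rightarrow> real \<Rightarrow> complex) \<Rightarrow> real \<Rightarrow> real \<Rightarrow> real \<Rightarrow> complex" where
  "wigner hbar \<psi> x p t =
     complex_of_real (1 / (2 * pi * hbar)) * (LINT s|lborel. wigner_integrand hbar \<psi> x p t s)"

definition kappa :: "(real \<Rightarrow> real) \<Rightarrow> real \<Rightarrow> real" where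
  "kappa \<sigma> t = 1 / (\<sigma> t * sqrt 2)"

definition epsilon :: "real \<Rightarrow> real \<Rightarrow> (real \<Rightarrow> real) \<Rightarrow> real \<Rightarrow> real \<Rightarrow> real \<Rightarrow> real" where
  "epsilon hbar \<alpha> \<sigma> x p t =
     (kappa \<sigma> t)\<^sup>2 * x\<^sup>2
     + (\<sigma> t * deriv \<sigma> t * (x / \<alpha>) * kappa \<sigma> t + p / (kappa \<sigma> t * hbar))\<^sup>2"

lemma pderiv_hermite_Suc: "pderiv (hermite (Suc n)) = smult (2 * real (Suc n)) (hermite n)"
proof (induction n rule: hermite.induct)
  case 1
  show ?case by (simp add: pderiv_pCons)
next
  case 2
  show ?case by (simp add: pderiv_pCons pderiv_mult pderiv_diff pderiv_smult one_pCons)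
next
  case (3 n)
  have "pderiv (hermite (Suc (Suc (Suc n)))) =
      smult 2 (hermite (Suc (Suc n))) + [:0, 2:] * pderiv (hermite (Suc (Suc n)))
      - smult (2 * real (Suc (Suc n))) (pderiv (hermite (Suc n)))"
    by (simp only: hermite.simps(3)[of "Suc n"] pderiv_diff pderiv_mult pderiv_smult)
      (simp add: pderiv_pCons algebra_simps del: hermite.simps(3))
  also have "\<dots> = smult 2 (hermite (Suc (Suc n))) +
      smult (2 * real (Suc (Suc n)))
        ([:0, 2:] * hermite (Suc n) - smult (2 * real (Suc n)) (hermite n))"
    by (simp only: 3) (simp add: algebra_simps smult_diff_right del: hermite.simps(3))
  also have "\<dots> = smult (2 * real (Suc (Suc (Suc n)))) (hermite (Suc (Suc n)))"
    by (simp only: hermite.simps(3)[symmetric])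
      (simp add: smult_add_left[symmetric] del: hermite.simps(3))
  finally show ?case .
qed

lemma hermite_Suc: "hermite (Suc n) = [:0, 2:] * hermite n - pderiv (hermite n)"
  by (cases n) (simp_all add: pderiv_hermite_Suc one_pCons)

lemma degree_hermite: "degree (hermite n) = n"
proof -
  have "degree (hermite n) \<le> n \<and> coeff (hermite n) n = 2 ^ n"
  proof (induction n)
    case 0
    show ?case by simp
  next
    case (Suc n)
    have "degree ([:0, 2:] * hermite n) \<le> Suc n"
      using Suc degree_mult_le[of "[:0, 2:]" "hermite n"] by simp
    moreover have "degree (pderiv (hermite n)) \<le> Suc n"
      using Suc by (auto simp: degree_pderiv)
    ultimately have "degree (hermite (Suc n)) \<le> Suc n"
      unfolding hermite_Suc by (rule degree_diff_le)
    moreover have "coeff (hermite n) (Suc (Suc n)) = 0"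
      using Suc by (intro coeff_eq_0) auto
    ultimately show ?case
      using Suc by (simp add: hermite_Suc coeff_pderiv)
  qed
  then show ?thesis
    by (metis antisym le_degree power_not_zero zero_neq_numeral)
qed

lemma hermite_rodrigues:
  "(deriv ^^ n) (\<lambda>y::real. exp (- y\<^sup>2)) = (\<lambda>y. (- 1) ^ n * poly (hermite n) y * exp (- y\<^sup>2))"
proof (induction n)
  case 0
  show ?case by simp
next
  case (Suc n)
  have "((\<lambda>y. (- 1) ^ n * poly (hermite n) y * exp (- y\<^sup>2)) has_real_derivative
      (- 1) ^ Suc n * poly (hermite (Suc n)) y * exp (- y\<^sup>2)) (at y)" for y
    by (auto intro!: derivative_eq_intros simp: hermite_Suc algebra_simps)
  then show ?case
    by (auto simp: Suc intro!: DERIV_imp_deriv)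
qed

text \<open>
  The Bochner integral of a non-integrable function is 0 by convention; this does not occur in
  \<^const>\<open>wigner\<close> applied to \<^const>\<open>Psi\<close>.
\<close>

lemma integrable_poly_gauss:
  fixes q :: "real poly"
  assumes "0 < r"
  shows "integrable lborel (\<lambda>s. poly q s * normal_density 0 r s)"
proof -
  have "integrable lborel (\<lambda>s. \<Sum>k\<le>degree q. coeff q k * (normal_density 0 r s * (s - 0) ^ k))"
    using assms by (intro Bochner_Integration.integrable_sum integrable_mult_right
        integrable_normal_moment) auto
  then show ?thesis
    by (simp add: poly_altdef sum_distrib_left mult_ac)
qed

lemma integrable_wigner_integrand_Psi:
  assumes "0 < \<sigma> t"
  shows "integrable lborel (wigner_integrand hbar (Psi \<alpha> \<beta> \<sigma> E n) x p t)"
proof -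
  let ?c = "1 / (sqrt 2 * \<sigma> t)"
  define q where "q = pcompose (hermite n) [: x * ?c, - ?c / 2 :] * pcompose (hermite n) [: x * ?c, ?c / 2 :]"
  define C where "C = (1 / sqrt (2 ^ n * fact n))\<^sup>2 * (1 / sqrt (sqrt (2 * pi) * \<sigma> t))\<^sup>2
      * exp (- x\<^sup>2 / (2 * (\<sigma> t)\<^sup>2)) * sqrt (2 * pi * (2 * \<sigma> t)\<^sup>2)"
  have q: "poly q s = poly (hermite n) ((x - s / 2) / (sqrt 2 * \<sigma> t))
      * poly (hermite n) ((x + s / 2) / (sqrt 2 * \<sigma> t))" for s
    using assms by (simp add: q_def poly_pcompose field_simps)
  have e: "exp (- ((x - s / 2)\<^sup>2 / (4 * (\<sigma> t)\<^sup>2))) * exp (- ((x + s / 2)\<^sup>2 / (4 * (\<sigma> t)\<^sup>2)))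
      = exp (- x\<^sup>2 / (2 * (\<sigma> t)\<^sup>2)) * (sqrt (2 * pi * (2 * \<sigma> t)\<^sup>2) * normal_density 0 (2 * \<sigma> t) s)" for s
    using assms unfolding normal_density_def
    by (simp add: exp_add[symmetric] field_simps power2_eq_square)
  have n: "norm (wigner_integrand hbar (Psi \<alpha> \<beta> \<sigma> E n) x p t s)
      = \<bar>C * (poly q s * normal_density 0 (2 * \<sigma> t) s)\<bar>" for s
  proof -
    define a where "a = 1 / sqrt (2 ^ n * fact n)"
    define b where "b = 1 / sqrt (sqrt (2 * pi) * \<sigma> t)"
    have ab: "\<bar>a\<bar> = a" "\<bar>b\<bar> = b"
      using assms by (simp_all add: a_def b_def)
    have "norm (wigner_integrand hbar (Psi \<alpha> \<beta> \<sigma> E n) x p t s) =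
        a\<^sup>2 * b\<^sup>2
        * (exp (- ((x - s / 2)\<^sup>2 / (4 * (\<sigma> t)\<^sup>2))) * exp (- ((x + s / 2)\<^sup>2 / (4 * (\<sigma> t)\<^sup>2))))
        * \<bar>poly q s\<bar>"
      unfolding q wigner_integrand_def Psi_def norm_mult complex_mod_cnj norm_exp_eq_Re norm_of_real
        a_def[symmetric] b_def[symmetric] ab abs_mult power2_eq_square[of a] power2_eq_square[of b]
      by simp
    also have "\<dots> = C * normal_density 0 (2 * \<sigma> t) s * \<bar>poly q s\<bar>"
      by (simp only: e C_def a_def b_def mult.assoc)
    also have "\<dots> = \<bar>C * (poly q s * normal_density 0 (2 * \<sigma> t) s)\<bar>"
    proof -
      have "0 \<le> C" using assms by (simp add: C_def)
      then show ?thesis by (simp add: abs_mult)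
    qed
    finally show ?thesis .
  qed
  have "integrable lborel (\<lambda>s. C * (poly q s * normal_density 0 (2 * \<sigma> t) s))"
    using assms by (intro integrable_mult_right integrable_poly_gauss) auto
  moreover have "wigner_integrand hbar (Psi \<alpha> \<beta> \<sigma> E n) x p t \<in> borel_measurable lborel"
  proof -
    have [measurable]: "poly (hermite n) \<in> borel_measurable borel"
      by (intro borel_measurable_continuous_onI continuous_intros)
    have [measurable]: "cnj \<in> borel_measurable borel"
      by (intro borel_measurable_continuous_onI continuous_intros)
    show ?thesis
      unfolding wigner_integrand_def[abs_def] Psi_def by measurable
  qed
  ultimately show ?thesis
    by (rule Bochner_Integration.integrable_bound) (simp add: n)
qed

end

theory Submission
  imports Defs "HOL-Real_Asymp.Real_Asymp"
begin

text \<open>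
  The substitution \<open>s = 2 \<surd>2 \<sigma> u\<close> reduces the Wigner integral to
  \<open>\<integral> H\<^sub>n(X - u) H\<^sub>n(X + u) exp (- u\<^sup>2 - 2 \<i> Y u) du\<close> with \<open>\<epsilon> = X\<^sup>2 + Y\<^sup>2\<close>.
  Formally the weight is \<open>exp (- Y\<^sup>2) exp (- w\<^sup>2)\<close> with \<open>w = u + \<i> Y\<close>. Instead of moving the contour,
  one integrates by parts: the functional \<open>\<Phi>\<close> given by this weight satisfies
  \<open>\<Phi>(q') = \<Phi>(2 w q)\<close>, so that \<open>\<Phi>(H\<^sub>m\<^sub>+\<^sub>1(w + a) q) = 2 a \<Phi>(H\<^sub>m(w + a) q) + \<Phi>(H\<^sub>m(w + a) q')\<close>.
  Iterating with \<open>q = H\<^sub>n(w + b)\<close> gives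
  \<open>\<Phi>(H\<^sub>n(w + a) H\<^sub>n(w + b)) = 2\<^sup>n n! L\<^sub>n(- 2 a b) \<Phi>(1)\<close>; take \<open>a = - X - \<i> Y\<close> and
  \<open>b = X - \<i> Y\<close>, for which \<open>- 2 a b = 2 \<epsilon>\<close>.
\<close>

section \<open>The oscillating Gaussian weight and its functional on polynomials\<close>

definition gauss_wave :: "real \<Rightarrow> real \<Rightarrow> complex" where
  "gauss_wave Y u = exp (- (complex_of_real u)\<^sup>2 - 2 * \<i> * complex_of_real Y * complex_of_real u)"

definition gauss_functional :: "real \<Rightarrow> complex poly \<Rightarrow> complex" where
  "gauss_functional Y q = (LINT u|lborel. poly q (complex_of_real u) * gauss_wave Y u)"

lemma norm_gauss_wave: "norm (gauss_wave Y u) = exp (- u\<^sup>2)"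
  by (simp add: gauss_wave_def norm_exp_eq_Re power2_eq_square)

lemma continuous_on_gauss_wave: "continuous_on A (gauss_wave Y)"
  unfolding gauss_wave_def by (intro continuous_intros)

lemma integrable_poly_gauss_wave:
  "integrable lborel (\<lambda>u. poly q (complex_of_real u) * gauss_wave Y u)"
proof -
  have "integrable lborel (\<lambda>u. complex_of_real u ^ k * gauss_wave Y u)" for k
  proof -
    \<comment> \<open>With variance 1/2 the normal density is exp (- u^2) / sqrt pi, which explains
      the factor \<open>sqrt pi\<close> below.\<close>
    define r :: real where "r = 1 / sqrt 2"
    have r: "0 < r" "r\<^sup>2 = 1 / 2"
      by (simp_all add: r_def power_divide)
    have "integrable lborel (\<lambda>u. sqrt pi * (poly (monom 1 k) u * normal_density 0 r u))"
      by (intro integrable_mult_right integrable_poly_gauss r)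
    moreover have "(\<lambda>u. complex_of_real u ^ k * gauss_wave Y u) \<in> borel_measurable lborel"
      by (simp, intro borel_measurable_continuous_onI continuous_intros continuous_on_gauss_wave)
    ultimately show ?thesis
      by (rule Bochner_Integration.integrable_bound)
        (simp add: norm_mult norm_power norm_gauss_wave normal_density_def r poly_monom abs_mult
          power_abs)
  qed
  then have "integrable lborel
      (\<lambda>u. \<Sum>k\<le>degree q. coeff q k * (complex_of_real u ^ k * gauss_wave Y u))"
    by (intro Bochner_Integration.integrable_sum integrable_mult_right)
  then show ?thesis
    by (simp add: poly_altdef sum_distrib_right mult.assoc)
qed

lemma gauss_functional_add:
  "gauss_functional Y (p + q) = gauss_functional Y p + gauss_functional Y q"
  by (simp add: gauss_functional_def distrib_right integrable_poly_gauss_wave)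

lemma gauss_functional_smult: "gauss_functional Y (smult c q) = c * gauss_functional Y q"
  by (simp add: gauss_functional_def mult.assoc)

lemma gauss_functional_diff:
  "gauss_functional Y (p - q) = gauss_functional Y p - gauss_functional Y q"
  by (simp add: gauss_functional_def left_diff_distrib integrable_poly_gauss_wave)

text \<open>This is the Fourier transform of a Gaussian, read off from the characteristic function
  of the standard normal law at - sqrt 2 * Y after substituting v = sqrt 2 * u.\<close>

lemma gauss_functional_1: "gauss_functional Y 1 = complex_of_real (sqrt pi * exp (- Y\<^sup>2))"
proof -
  have "complex_of_real (exp (- Y\<^sup>2)) = char std_normal_distribution (- sqrt 2 * Y)"
    by (simp add: char_std_normal_distribution power_mult_distrib)
  also have "\<dots> = (LINT v|lborel. std_normal_density v *\<^sub>R iexp (- sqrt 2 * Y * v))"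
    unfolding char_def by (subst integral_density) auto
  also have "\<dots> = sqrt 2 *\<^sub>R
      (LINT u|lborel. std_normal_density (sqrt 2 * u) *\<^sub>R iexp (- sqrt 2 * Y * (sqrt 2 * u)))"
    by (subst lborel_integral_real_affine[of "sqrt 2" _ 0]) simp_all
  also have "\<dots> = sqrt 2 *\<^sub>R (LINT u|lborel. complex_of_real (1 / sqrt (2 * pi)) * gauss_wave Y u)"
  proof -
    have "std_normal_density (sqrt 2 * u) *\<^sub>R iexp (- sqrt 2 * Y * (sqrt 2 * u))
        = complex_of_real (1 / sqrt (2 * pi)) * gauss_wave Y u" for u
    proof -
      have phase: "- sqrt 2 * Y * (sqrt 2 * u) = - 2 * Y * u"
        using real_sqrt_mult_self[of 2] by (simp add: mult_ac)
      have "iexp (- sqrt 2 * Y * (sqrt 2 * u)) = exp (- 2 * \<i> * complex_of_real Y * complex_of_real u)"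
        unfolding phase by (simp add: mult_ac)
      moreover have "std_normal_density (sqrt 2 * u) = 1 / sqrt (2 * pi) * exp (- u\<^sup>2)"
        by (simp add: std_normal_density_def power_mult_distrib)
      moreover have "gauss_wave Y u
          = complex_of_real (exp (- u\<^sup>2)) * exp (- 2 * \<i> * complex_of_real Y * complex_of_real u)"
        by (simp add: gauss_wave_def exp_add[symmetric] exp_of_real[symmetric])
      ultimately show ?thesis
        by (simp only: scaleR_conv_of_real of_real_mult mult.assoc)
    qed
    then show ?thesis by simp
  qed
  also have "\<dots> = complex_of_real (1 / sqrt pi) * gauss_functional Y 1"
    by (simp add: gauss_functional_def scaleR_conv_of_real real_sqrt_mult)
  finally show ?thesis
    by (simp add: field_simps)
qed

lemma tendsto_poly_gauss_wave:
  "((\<lambda>u. poly q (complex_of_real u) * gauss_wave Y u) \<longlongrightarrow> 0) at_infinity"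
proof -
  have pow: "((\<lambda>x. x ^ k * exp (- x\<^sup>2)) \<longlongrightarrow> (0::real)) at_top" for k
  proof -
    have "((\<lambda>x. (x ^ k / exp x) * exp (x - x\<^sup>2)) \<longlongrightarrow> (0::real) * 0) at_top"
      by (intro tendsto_mult tendsto_power_div_exp_0) real_asymp
    then show ?thesis
      by (simp add: exp_diff exp_minus field_simps)
  qed
  have "((\<lambda>u. complex_of_real u ^ k * gauss_wave Y u) \<longlongrightarrow> 0) at_infinity" for k
  proof (rule tendsto_norm_zero_cancel)
    have "((\<lambda>u::real. (norm u) ^ k * exp (- (norm u)\<^sup>2)) \<longlongrightarrow> 0) at_infinity"
      by (rule filterlim_compose[OF pow filterlim_norm_at_top])
    then show "((\<lambda>u. norm (complex_of_real u ^ k * gauss_wave Y u)) \<longlongrightarrow> 0) at_infinity"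
      by (simp add: norm_mult norm_power norm_gauss_wave)
  qed
  then have "((\<lambda>u. \<Sum>k\<le>degree q. coeff q k * (complex_of_real u ^ k * gauss_wave Y u))
      \<longlongrightarrow> 0) at_infinity"
    by (intro tendsto_null_sum tendsto_mult_right_zero)
  then show ?thesis
    by (simp add: poly_altdef sum_distrib_right mult.assoc)
qed

text \<open>Integration by parts: \<open>r\<close> is chosen so that \<open>poly r\<close> times the
  weight is the derivative of \<open>poly q\<close> times the weight, whose limits at both
  infinities are 0. The linear factor is 2 * w with w = u + i Y.\<close>

lemma gauss_functional_pderiv:
  "gauss_functional Y (pderiv q) = gauss_functional Y ([:2 * \<i> * complex_of_real Y, 2:] * q)"
proof -
  define r where "r = pderiv q - [:2 * \<i> * complex_of_real Y, 2:] * q"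
  define F where "F = (\<lambda>u. poly q (complex_of_real u) * gauss_wave Y u)"
  have deriv: "(F has_vector_derivative poly r (complex_of_real u) * gauss_wave Y u) (at u)" for u
  proof -
    \<comment> \<open>Differentiation takes place in a complex variable, where the polynomial rules
      apply, and is then restricted to the real line.\<close>
    have "((\<lambda>z. poly q z * exp (- z\<^sup>2 - 2 * \<i> * complex_of_real Y * z)) has_field_derivative
        poly r (complex_of_real u) * gauss_wave Y u) (at (complex_of_real u))"
      unfolding r_def gauss_wave_def
      by (auto intro!: derivative_eq_intros simp: algebra_simps)
    from has_vector_derivative_real_field[OF this] show ?thesis
      by (simp add: F_def gauss_wave_def)
  qed
  have "(LBINT u=-\<infinity>..\<infinity>. poly r (complex_of_real u) * gauss_wave Y u) = 0 - 0"
  proof (rule interval_integral_FTC_integrable)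
    show "((F \<circ> real_of_ereal) \<longlongrightarrow> 0) (at_right (-\<infinity>))" "((F \<circ> real_of_ereal) \<longlongrightarrow> 0) (at_left \<infinity>)"
      using tendsto_mono[OF at_top_le_at_infinity tendsto_poly_gauss_wave]
        tendsto_mono[OF at_bot_le_at_infinity tendsto_poly_gauss_wave]
      by (simp_all add: ereal_tendsto_simps F_def)
    show "isCont (\<lambda>u. poly r (complex_of_real u) * gauss_wave Y u) x" for x
      unfolding gauss_wave_def by (intro continuous_intros)
    show "set_integrable lborel (einterval (-\<infinity>) \<infinity>) (\<lambda>u. poly r (complex_of_real u) * gauss_wave Y u)"
      by (simp add: set_integrable_def integrable_poly_gauss_wave)
  qed (use deriv in auto)
  then have "gauss_functional Y r = 0"
    by (simp add: gauss_functional_def interval_lebesgue_integral_def set_lebesgue_integral_def)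
  then show ?thesis
    by (simp add: r_def gauss_functional_diff)
qed

section \<open>Hermite polynomials with a complex shift\<close>

text \<open>\<open>shifted_hermite c n\<close> is the polynomial \<open>H\<^sub>n(u + c)\<close> in \<open>u\<close>.\<close>

primrec shifted_hermite :: "complex \<Rightarrow> nat \<Rightarrow> complex poly" where
  "shifted_hermite c 0 = 1"
| "shifted_hermite c (Suc n) = [:2 * c, 2:] * shifted_hermite c n - pderiv (shifted_hermite c n)"

lemma pderiv_shifted_hermite:
  "pderiv (shifted_hermite c n) = smult (2 * of_nat n) (shifted_hermite c (n - 1))"
proof (induction n)
  case 0
  show ?case by simp
next
  case (Suc n)
  show ?case
  proof (cases n)
    case 0
    then show ?thesis by (simp add: pderiv_pCons one_pCons)
  next
    case (Suc k)
    define A where "A = [:2 * c, 2:]"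
    have A: "pderiv A = [:2:]"
      by (simp add: A_def pderiv_pCons)
    have n: "shifted_hermite c n = A * shifted_hermite c k - pderiv (shifted_hermite c k)"
      by (simp only: Suc shifted_hermite.simps A_def)
    have IH: "pderiv (shifted_hermite c n) = smult (2 * of_nat n) (shifted_hermite c k)"
      using Suc.IH Suc by simp
    \<comment> \<open>The product rule leaves A * H_n' - H_n''. By the induction hypothesis this is
      2 n (A * H_k - H_k') = 2 n H_n, where n = k + 1.\<close>
    have "pderiv (shifted_hermite c (Suc n)) = smult 2 (shifted_hermite c n)
        + smult (2 * of_nat n) (A * shifted_hermite c k - pderiv (shifted_hermite c k))"
      unfolding shifted_hermite.simps A_def[symmetric] pderiv_diff pderiv_mult IH A pderiv_smult
      by (simp add: smult_diff_right)
    also have "\<dots> = smult (2 * of_nat (Suc n)) (shifted_hermite c n)"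
      unfolding n[symmetric] by (simp add: smult_add_left[symmetric] algebra_simps)
    finally show ?thesis by simp
  qed
qed

lemma higher_pderiv_shifted_hermite:
  "(pderiv ^^ k) (shifted_hermite c n) =
    (if k \<le> n then smult (2 ^ k * (fact n / fact (n - k))) (shifted_hermite c (n - k)) else 0)"
proof (induction k)
  case 0
  show ?case by simp
next
  case (Suc k)
  show ?case
  proof (cases "Suc k \<le> n")
    case True
    then obtain j where "n = Suc k + j" using le_Suc_ex by blast
    moreover have "2 ^ k * (fact n / fact (Suc j)) * (2 * of_nat (Suc j))
        = (2 ^ Suc k * (fact n / fact j) :: complex)"
      by (simp add: field_simps del: of_nat_Suc)
    ultimately show ?thesis
      using Suc by (simp add: pderiv_smult pderiv_shifted_hermite[of c "Suc j"] Suc_diff_le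
          del: shifted_hermite.simps of_nat_Suc fact_Suc power_Suc)
  next
    case False
    with Suc show ?thesis by (auto simp: pderiv_smult not_le less_Suc_eq_le)
  qed
qed

text \<open>The derivative rule turns the first-order recursion of \<open>shifted_hermite\<close>
  into the three-term recurrence of \<open>hermite\<close>, along which the induction runs.\<close>

lemma poly_shifted_hermite:
  "poly (shifted_hermite (complex_of_real X) n) (complex_of_real u)
    = complex_of_real (poly (hermite n) (u + X))"
proof (induction n rule: hermite.induct)
  case (3 n)
  then show ?case
    by (simp only: shifted_hermite.simps(2)[of _ "Suc n"] hermite.simps(3)
        pderiv_shifted_hermite[of _ "Suc n"] poly_diff poly_mult poly_smult)
      (simp add: algebra_simps del: shifted_hermite.simps hermite.simps)
qed (simp_all add: algebra_simps)

lemma poly_hermite_minus: "poly (hermite n) (- y) = (- 1) ^ n * poly (hermite n) y"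
  by (induction n rule: hermite.induct) (simp_all add: algebra_simps)

section \<open>Iterated integration by parts and the Laguerre sum\<close>

text \<open>Pascal's rule, in the shape needed to iterate a step that either multiplies by
  \<open>x\<close> or advances \<open>f\<close> by one index.\<close>

lemma sum_binomial_Suc:
  fixes x :: "'a::comm_ring_1"
  shows "(\<Sum>k\<le>Suc m. of_nat (Suc m choose k) * x ^ (Suc m - k) * f k) =
    x * (\<Sum>k\<le>m. of_nat (m choose k) * x ^ (m - k) * f k)
    + (\<Sum>k\<le>m. of_nat (m choose k) * x ^ (m - k) * f (Suc k))"
proof -
  have "x * (\<Sum>k\<le>m. of_nat (m choose k) * x ^ (m - k) * f k)
      = (\<Sum>k\<le>m. of_nat (m choose k) * x ^ (Suc m - k) * f k)"
    by (simp add: sum_distrib_left Suc_diff_le mult_ac)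
  \<comment> \<open>The added term k = m + 1 has binomial coefficient 0.\<close>
  also have "\<dots> = (\<Sum>k\<le>Suc m. of_nat (m choose k) * x ^ (Suc m - k) * f k)"
    by (simp add: binomial_eq_0)
  finally show ?thesis
    by (simp add: sum.atMost_Suc_shift sum.distrib algebra_simps del: sum.atMost_Suc)
qed

lemma gauss_functional_shifted_hermite:
  "gauss_functional Y (shifted_hermite (a + \<i> * complex_of_real Y) m * q) =
    (\<Sum>k\<le>m. of_nat (m choose k) * (2 * a) ^ (m - k) * gauss_functional Y ((pderiv ^^ k) q))"
proof (induction m arbitrary: q)
  case 0
  show ?case by simp
next
  case (Suc m)
  let ?S = "shifted_hermite (a + \<i> * complex_of_real Y) m"
  \<comment> \<open>The linear factor of the recursion splits as 2 a + 2 w, and - S' q = S q' - (S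
    q)'. The last bracket, 2 w S q - (S q)', is annihilated by the functional.\<close>
  have "shifted_hermite (a + \<i> * complex_of_real Y) (Suc m) * q
      = smult (2 * a) (?S * q) + ?S * pderiv q
        + ([:2 * \<i> * complex_of_real Y, 2:] * (?S * q) - pderiv (?S * q))"
    by (simp add: pderiv_mult algebra_simps smult_add_left)
  then have "gauss_functional Y (shifted_hermite (a + \<i> * complex_of_real Y) (Suc m) * q)
      = 2 * a * gauss_functional Y (?S * q) + gauss_functional Y (?S * pderiv q)"
    by (simp add: gauss_functional_add gauss_functional_diff gauss_functional_smult
        gauss_functional_pderiv)
  then show ?case
    by (simp only: Suc.IH sum_binomial_Suc funpow_Suc_right o_apply)
qed

lemma gauss_functional_shifted_hermite_1:
  "gauss_functional Y (shifted_hermite (a + \<i> * complex_of_real Y) m)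
    = (2 * a) ^ m * gauss_functional Y 1"
proof -
  have "(pderiv ^^ k) 1 = (0 :: complex poly)" if "k > 0" for k
    \<comment> \<open>The constant 1 is \<open>shifted_hermite 0 0\<close>.\<close>
    using higher_pderiv_shifted_hermite[of k 0 0] that by simp
  then have "(\<Sum>k\<in>{..m} - {0}. of_nat (m choose k) * (2 * a) ^ (m - k)
      * gauss_functional Y ((pderiv ^^ k) 1)) = 0"
    using gauss_functional_smult[of Y 0 0] by (intro sum.neutral) auto
  then show ?thesis
    using gauss_functional_shifted_hermite[of Y a m 1] by (simp add: sum.remove[of "{..m}" 0])
qed

text \<open>The k-th derivative of the second factor is 2^k n! / (n - k)! times the polynomial of
  degree n - k, on which the functional is (2 b)^(n - k) times its value at 1. With j = n - k the
  powers of two combine to 2^n * 2^j, and reversing the sum gives the Laguerre form.\<close>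

lemma gauss_functional_hermite_product:
  "gauss_functional Y (shifted_hermite (a + \<i> * complex_of_real Y) n
      * shifted_hermite (b + \<i> * complex_of_real Y) n)
    = 2 ^ n * fact n * (\<Sum>k\<le>n. of_nat (n choose k) * ((2 * a * b) ^ k / fact k))
      * gauss_functional Y 1"
proof -
  let ?f = "\<lambda>k. of_nat (n choose k) * ((2 * a * b) ^ k / fact k)"
  have "gauss_functional Y (shifted_hermite (a + \<i> * complex_of_real Y) n
      * shifted_hermite (b + \<i> * complex_of_real Y) n)
    = (\<Sum>k\<le>n. 2 ^ n * fact n * gauss_functional Y 1 * ?f (n - k))"
    unfolding gauss_functional_shifted_hermite
  proof (intro sum.cong refl)
    fix k assume "k \<in> {..n}"
    then obtain j where "n = k + j" using le_Suc_ex by auto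
    then show "of_nat (n choose k) * (2 * a) ^ (n - k)
        * gauss_functional Y ((pderiv ^^ k) (shifted_hermite (b + \<i> * complex_of_real Y) n))
      = 2 ^ n * fact n * gauss_functional Y 1 * ?f (n - k)"
      using binomial_symmetric[of k n]
      by (simp add: higher_pderiv_shifted_hermite gauss_functional_smult
          gauss_functional_shifted_hermite_1 power_add power_mult_distrib)
  qed
  also have "\<dots> = (\<Sum>k\<le>n. 2 ^ n * fact n * gauss_functional Y 1 * ?f k)"
    by (rule sum.reindex_bij_witness[of _ "\<lambda>k. n - k" "\<lambda>k. n - k"]) auto
  finally show ?thesis
    by (simp add: sum_distrib_left mult_ac)
qed

section \<open>Evaluation of the Wigner integral\<close>

lemma hermite_wigner_integral:
  "(LINT u|lborel. complex_of_real (poly (hermite n) (X - u) * poly (hermite n) (X + u)) * gauss_wave Y u)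
    = complex_of_real ((- 1) ^ n * 2 ^ n * fact n * sqrt pi * exp (- Y\<^sup>2)
        * laguerre n (2 * (X\<^sup>2 + Y\<^sup>2)))"
proof -
  \<comment> \<open>These values make the shifts a + i Y = - X and b + i Y = X real. Parity turns
    H_n(u - X) into (-1)^n H_n(X - u), the source of the sign.\<close>
  define a b where "a = - complex_of_real X - \<i> * complex_of_real Y"
    and "b = complex_of_real X - \<i> * complex_of_real Y"
  have ab: "2 * a * b = complex_of_real (- (2 * (X\<^sup>2 + Y\<^sup>2)))"
    by (simp add: a_def b_def algebra_simps power2_eq_square)
  have "complex_of_real (poly (hermite n) (X - u) * poly (hermite n) (X + u)) * gauss_wave Y u
      = (- 1) ^ n * (poly (shifted_hermite (a + \<i> * complex_of_real Y) n
          * shifted_hermite (b + \<i> * complex_of_real Y) n) (complex_of_real u) * gauss_wave Y u)" for u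
    using poly_hermite_minus[of n "u - X"] poly_shifted_hermite[of "- X" n u]
      poly_shifted_hermite[of X n u]
    by (simp add: a_def b_def add.commute)
  then have "(LINT u|lborel. complex_of_real (poly (hermite n) (X - u) * poly (hermite n) (X + u))
        * gauss_wave Y u)
      = (- 1) ^ n * gauss_functional Y (shifted_hermite (a + \<i> * complex_of_real Y) n
          * shifted_hermite (b + \<i> * complex_of_real Y) n)"
    by (simp only: gauss_functional_def integral_mult_right_zero)
  then show ?thesis
    unfolding gauss_functional_hermite_product gauss_functional_1 ab laguerre_def by simp
qed

lemma wigner_Psi:
  fixes \<sigma> :: "real \<Rightarrow> real"
  assumes "0 < \<sigma> t" "hbar \<noteq> 0" "\<alpha> \<noteq> 0"
  shows "wigner hbar (Psi \<alpha> \<beta> \<sigma> E n) x p t =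
      complex_of_real ((- 1) ^ n / (pi * hbar) * exp (- epsilon hbar \<alpha> \<sigma> x p t)
        * laguerre n (2 * epsilon hbar \<alpha> \<sigma> x p t))"
proof -
  define X Y where "X = kappa \<sigma> t * x"
    and "Y = \<sigma> t * deriv \<sigma> t * (x / \<alpha>) * kappa \<sigma> t + p / (kappa \<sigma> t * hbar)"
  have eps: "epsilon hbar \<alpha> \<sigma> x p t = X\<^sup>2 + Y\<^sup>2"
    by (simp add: epsilon_def X_def Y_def power_mult_distrib)
  \<comment> \<open>The scale makes s / 2 = sqrt 2 * \<sigma> t * u, so the Hermite arguments become
    X - u and X + u and the Gaussian in the new variable is exp (- u^2).\<close>
  define d where "d = 2 * sqrt 2 * \<sigma> t"
  have sqrt2: "sqrt 2 * (sqrt 2 * z) = 2 * z" for z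
    by (simp flip: mult.assoc)
  define C where "C = exp (- X\<^sup>2) / (2 ^ n * fact n * (sqrt (2 * pi) * \<sigma> t))"
  have integrand: "wigner_integrand hbar (Psi \<alpha> \<beta> \<sigma> E n) x p t (d * u) = complex_of_real C *
      (complex_of_real (poly (hermite n) (X - u) * poly (hermite n) (X + u)) * gauss_wave Y u)" for u
  proof -
    define h where "h = d * u / 2"
    define k1 k2 where "k1 = 1 / sqrt (2 ^ n * fact n)" and "k2 = 1 / sqrt (sqrt (2 * pi) * \<sigma> t)"
    define e where "e = (\<lambda>y. - complex_of_real (y\<^sup>2 / (4 * (\<sigma> t)\<^sup>2))
          - \<i> * complex_of_real (deriv \<sigma> t / (4 * \<alpha> * \<sigma> t) * y\<^sup>2)
          - \<i> * complex_of_real (\<beta> * E t))"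
    \<comment> \<open>In the real part the mixed terms in x h cancel. In the imaginary part the
      squares and the energy phase cancel, leaving terms linear in u that add up to - 2 Y u.\<close>
    have "cnj (e (x - h)) + e (x + h) + - \<i> * complex_of_real (p * (d * u) / hbar)
        = complex_of_real (- X\<^sup>2) + (- (complex_of_real u)\<^sup>2 - 2 * \<i> * complex_of_real Y * complex_of_real u)"
    proof (rule complex_eqI)
      show "Re (cnj (e (x - h)) + e (x + h) + - \<i> * complex_of_real (p * (d * u) / hbar))
        = Re (complex_of_real (- X\<^sup>2) + (- (complex_of_real u)\<^sup>2 - 2 * \<i> * complex_of_real Y * complex_of_real u))"
        using assms by (simp add: e_def h_def d_def X_def kappa_def field_simps power2_eq_square)
      show "Im (cnj (e (x - h)) + e (x + h) + - \<i> * complex_of_real (p * (d * u) / hbar))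
        = Im (complex_of_real (- X\<^sup>2) + (- (complex_of_real u)\<^sup>2 - 2 * \<i> * complex_of_real Y * complex_of_real u))"
        using assms by (simp add: e_def h_def d_def Y_def kappa_def field_simps power2_eq_square sqrt2)
    qed
    then have ex: "exp (cnj (e (x - h))) * exp (e (x + h)) * exp (- \<i> * complex_of_real (p * (d * u) / hbar))
        = complex_of_real (exp (- X\<^sup>2)) * gauss_wave Y u"
      by (simp only: gauss_wave_def exp_add[symmetric] exp_of_real[symmetric])
    have arg: "(x - h) / (sqrt 2 * \<sigma> t) = X - u" "(x + h) / (sqrt 2 * \<sigma> t) = X + u"
      using assms by (simp_all add: h_def d_def X_def kappa_def field_simps)
    have Psi: "Psi \<alpha> \<beta> \<sigma> E n y t = complex_of_real k1 * complex_of_real k2 * exp (e y)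
        * complex_of_real (poly (hermite n) (y / (sqrt 2 * \<sigma> t)))" for y
      by (simp only: Psi_def k1_def k2_def e_def)
    have C: "C = k1 * k1 * (k2 * k2) * exp (- X\<^sup>2)"
      using assms by (simp add: C_def k1_def k2_def)
    have "wigner_integrand hbar (Psi \<alpha> \<beta> \<sigma> E n) x p t (d * u)
        = complex_of_real (k1 * k1 * (k2 * k2)
            * (poly (hermite n) (X - u) * poly (hermite n) (X + u)))
          * (exp (cnj (e (x - h))) * exp (e (x + h)) * exp (- \<i> * complex_of_real (p * (d * u) / hbar)))"
      unfolding wigner_integrand_def h_def[symmetric] Psi arg
      by (simp add: exp_cnj)
    then show ?thesis
      unfolding ex C by simp
  qed
  \<comment> \<open>Substitution s = d u, with Jacobian d > 0.\<close>
  have "(LINT s|lborel. wigner_integrand hbar (Psi \<alpha> \<beta> \<sigma> E n) x p t s)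
      = d *\<^sub>R (LINT u|lborel. wigner_integrand hbar (Psi \<alpha> \<beta> \<sigma> E n) x p t (d * u))"
    using lborel_integral_real_affine[of d "wigner_integrand hbar (Psi \<alpha> \<beta> \<sigma> E n) x p t" 0] assms
    by (simp add: d_def)
  then have "wigner hbar (Psi \<alpha> \<beta> \<sigma> E n) x p t = complex_of_real
      (1 / (2 * pi * hbar) * (d * (C * ((- 1) ^ n * 2 ^ n * fact n * sqrt pi * exp (- Y\<^sup>2)
        * laguerre n (2 * (X\<^sup>2 + Y\<^sup>2))))))"
    unfolding wigner_def integrand integral_mult_right_zero hermite_wigner_integral
    by (simp add: scaleR_conv_of_real)
  also have "1 / (2 * pi * hbar) * (d * (C * ((- 1) ^ n * 2 ^ n * fact n * sqrt pi * exp (- Y\<^sup>2)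
        * laguerre n (2 * (X\<^sup>2 + Y\<^sup>2)))))
      = (- 1) ^ n / (pi * hbar) * (exp (- X\<^sup>2) * exp (- Y\<^sup>2)) * laguerre n (2 * (X\<^sup>2 + Y\<^sup>2))"
    using assms by (simp add: C_def d_def real_sqrt_mult field_simps)
  finally show ?thesis
    by (simp add: eps exp_add[symmetric])
qed

theorem theorem3:
  fixes hbar m \<alpha> \<beta> :: real
    and n :: nat
    and T :: "real set"
    and \<sigma> E :: "real \<Rightarrow> real"
  assumes "hbar > 0" and "m > 0"
    and "\<alpha> = - hbar / (2 * m)" and "\<beta> = 1 / hbar"
    and "open T" and "is_interval T"
    and "\<And>t. t \<in> T \<Longrightarrow> \<sigma> t > 0"
    and "\<sigma> C1_differentiable_on T"
    and "\<And>t. t \<in> T \<Longrightarrow>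
      (E has_real_derivative - (\<alpha> / (\<beta> * (\<sigma> t)\<^sup>2)) * (real n + 1 / 2)) (at t)"
  shows "\<forall>x p. \<forall>t\<in>T.
    wigner hbar (Psi \<alpha> \<beta> \<sigma> E n) x p t =
      complex_of_real ((- 1) ^ n / (pi * hbar) * exp (- epsilon hbar \<alpha> \<sigma> x p t)
        * laguerre n (2 * epsilon hbar \<alpha> \<sigma> x p t))"
  using assms by (simp add: wigner_Psi)

end
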